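(* Let $A\in\mathbb{Z}^{m\times n}$ have full row rank, i.e. $\operatorname{rank}(A)=m$, let $\boldsymbol b\in\mathbb{Z}^m$, let $P=\{\boldsymbol x\in\mathbb{R}^n: A\boldsymbol x=\boldsymbol b,\ \boldsymbol x\ge\boldsymbol 0\}$, and assume that $P\cap\mathbb{Z}^n\neq\emptyset$. Then the number of vertices of the integer hull $P_I=\operatorname{conv}(P\cap\mathbb{Z}^n)$ is bounded by $$\left(mn\|A\|_\infty\right)^{O\left(m^2\log\left(\sqrt{m}\,\|A\|_\infty\right)\right)}.$$
   Context: $\log$ is the logarithm with base two. $\|A\|_\infty$ denotes the maximum absolute value of an entry of the matrix $A$ (not an operator norm). $O(\cdot)$ is the usual Landau notation, with an absolute implied constant.
   Formalization: The exponent is C·max(1, m² log(√m‖A‖∞)); this differs from the stated one only for m = ‖A‖∞ = 1, where the log is 0 and the stated bound 1 fails (A = (1 1), b = 1 has two vertices). Also m ≥ 1 is assumed so that ‖A‖∞ is defined. *)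

theory Defs
  imports
    "HOL-Analysis.Polytope"
    "HOL-Analysis.Finite_Function_Topology"
    "Jordan_Normal_Form.DL_Rank"
begin

text \<open>
  The implied constant of the bound must not depend on the dimensions, so the dimensions have to be
  quantified inside the statement and cannot be types. Matrices and right-hand sides are therefore
  taken from \<open>Jordan_Normal_Form\<close>, while the real space of dimension \<open>n\<close> is the subspace
  \<open>{x. Poly_Mapping.keys x \<subseteq> {..<n}}\<close> of the real vector space \<open>nat \<Rightarrow>\<^sub>0 real\<close>. In this way
  the general notions \<^const>\<open>hull\<close>, \<^const>\<open>convex\<close> and \<^const>\<open>extreme_point_of\<close> apply.
\<close>

definition max_abs_entry :: "int mat \<Rightarrow> int" where
  "max_abs_entry A = Max (abs ` elements_mat A)"

definition std_polyhedron :: "int mat \<Rightarrow> int Matrix.vec \<Rightarrow> (nat \<Rightarrow>\<^sub>0 real) set" where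
  "std_polyhedron A b =
     {x. Poly_Mapping.keys x \<subseteq> {..<dim_col A} \<and>
         map_mat real_of_int A *\<^sub>v Matrix.vec (dim_col A) (Poly_Mapping.lookup x) = map_vec real_of_int b \<and>
         (\<forall>j. 0 \<le> Poly_Mapping.lookup x j)}"

definition integer_points :: "(nat \<Rightarrow>\<^sub>0 real) set" where
  "integer_points = {x. \<forall>j. Poly_Mapping.lookup x j \<in> \<int>}"

definition integer_hull :: "(nat \<Rightarrow>\<^sub>0 real) set \<Rightarrow> (nat \<Rightarrow>\<^sub>0 real) set" where
  "integer_hull P = convex hull (P \<inter> integer_points)"

definition vertices :: "(nat \<Rightarrow>\<^sub>0 real) set \<Rightarrow> (nat \<Rightarrow>\<^sub>0 real) set" where
  "vertices S = {v. v extreme_point_of S}"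

text \<open>
  An exponent \<open>O(m\<^sup>2 log (sqrt m * D))\<close>, where \<open>D\<close> is the largest absolute value of an entry, is
  rendered as \<open>C * max 1 (m\<^sup>2 * log 2 (sqrt m * D))\<close>. The cut-off at \<open>1\<close> has an effect for
  \<open>m = 1\<close> and \<open>D = 1\<close> only, by the lemma below. There the logarithm vanishes, and no constant
  could make up for that: for the matrix \<open>(1 1)\<close> and right-hand side \<open>1\<close> the integer hull is a
  segment with two vertices, whereas \<open>2 powr (C * 0) = 1\<close>.
\<close>

lemma exponent_cutoff_inactive:
  fixes m :: nat and D :: int
  assumes "1 \<le> m" "1 \<le> D" "\<not> (m = 1 \<and> D = 1)"
  shows "max 1 ((real m)\<^sup>2 * log 2 (sqrt (real m) * real_of_int D)) =
         (real m)\<^sup>2 * log 2 (sqrt (real m) * real_of_int D)"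
proof -
  have "1 \<le> (real m)\<^sup>2 * log 2 (sqrt (real m) * real_of_int D)"
  proof (cases "m = 1")
    case True
    then have "2 \<le> real_of_int D" using assms by linarith
    then have "log 2 2 \<le> log 2 (real_of_int D)" by (subst log_le_cancel_iff) auto
    then show ?thesis using True by simp
  next
    case False
    then have m: "2 \<le> real m" using assms by linarith
    have "sqrt 2 * 1 \<le> sqrt (real m) * real_of_int D"
      using m assms by (intro mult_mono) auto
    then have "log 2 (sqrt 2) \<le> log 2 (sqrt (real m) * real_of_int D)"
      using m assms by (subst log_le_cancel_iff) auto
    moreover have "log 2 (sqrt 2) = 1 / 2"
      by (simp add: log_def ln_sqrt)
    ultimately have l: "1 / 2 \<le> log 2 (sqrt (real m) * real_of_int D)" by simp
    have "2\<^sup>2 \<le> (real m)\<^sup>2" using m by (intro power_mono) auto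
    then have "4 * (1 / 2) \<le> (real m)\<^sup>2 * log 2 (sqrt (real m) * real_of_int D)"
      using l by (intro mult_mono) auto
    then show ?thesis by simp
  qed
  then show ?thesis by simp
qed

end

theory Submission
  imports Defs
begin

text \<open>
  Let \<open>D\<close> be the largest absolute value of an entry of \<open>A\<close>. If \<open>v\<close> is a vertex of the integer hull,
  then no nonzero integer vector \<open>c\<close> of the kernel satisfies \<open>\<bar>c\<bar> \<le> v\<close> entrywise, as \<open>v\<close> is the
  midpoint of \<open>v + c\<close> and \<open>v - c\<close>. Two pigeonhole arguments exploit this. First, the \<open>2 ^ s\<close> subset
  sums of the columns in the support of \<open>v\<close> are distinct, so the support has size
  \<open>s = O(m log (2 * m * D))\<close>. Second, any linearly dependent set of columns carries a nonzero
  integer relation with entries at most \<open>M = (2 * (m + 1) * D) ^ m\<close>, hence the columns with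
  \<open>v\<^sub>j \<ge> M\<close> are linearly independent and \<open>v\<close> is determined by the truncation \<open>min v M\<close>. There are at
  most \<open>(n * (M + 1)) ^ s\<close> truncations.
\<close>

unbundle no vec_syntax

section \<open>Small integer relations between columns\<close>

text \<open>Siegel's lemma: each of the \<open>card R\<close> sums taken at a point of the box
  \<open>{0..H}\<close> over \<open>L\<close> lies between \<open>-K\<close> and \<open>K\<close>
  with \<open>K = card L * H * D\<close>. By \<open>less\<close> the box has more points than there
  are value vectors, so two points collide, and their difference is the relation.\<close>

lemma siegel_pigeonhole:
  fixes a :: "'i \<Rightarrow> 'j \<Rightarrow> int" and D H :: nat
  assumes fin: "finite L" "finite R"
    and a: "\<forall>i\<in>R. \<forall>j\<in>L. \<bar>a i j\<bar> \<le> int D"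
    and less: "(2 * card L * H * D + 1) ^ card R < (H + 1) ^ card L"
  shows "\<exists>c::'j \<Rightarrow> int. (\<exists>j. c j \<noteq> 0) \<and> (\<forall>j. j \<notin> L \<longrightarrow> c j = 0) \<and>
    (\<forall>j. \<bar>c j\<bar> \<le> int H) \<and> (\<forall>i\<in>R. (\<Sum>j\<in>L. a i j * c j) = 0)"
proof -
  define K where "K = card L * H * D"
  define box where "box = L \<rightarrow>\<^sub>E {0..H}"
  define F where "F x = (\<lambda>i\<in>R. \<Sum>j\<in>L. a i j * int (x j))" for x :: "'j \<Rightarrow> nat"
  define target where "target = R \<rightarrow>\<^sub>E {- int K..int K}"
  have "F x \<in> target" if "x \<in> box" for x
  proof -
    have "\<bar>\<Sum>j\<in>L. a i j * int (x j)\<bar> \<le> int K" if "i \<in> R" for i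
    proof -
      have "\<bar>\<Sum>j\<in>L. a i j * int (x j)\<bar> \<le> (\<Sum>j\<in>L. \<bar>a i j * int (x j)\<bar>)"
        by (rule sum_abs)
      also have "\<dots> \<le> (\<Sum>j\<in>L. int D * int H)"
        using \<open>x \<in> box\<close> a that
        by (intro sum_mono) (auto simp: abs_mult box_def PiE_iff intro!: mult_mono)
      also have "\<dots> = int K" by (simp add: K_def)
      finally show ?thesis .
    qed
    then show ?thesis
      by (auto simp: F_def target_def PiE_iff abs_le_iff) (smt (verit, best))+
  qed
  then have sub: "F ` box \<subseteq> target" by auto
  have "finite target" using fin by (auto simp: target_def intro: finite_PiE)
  then have "card (F ` box) \<le> card target" using sub by (rule card_mono)
  also have "card target = (2 * K + 1) ^ card R"
    using fin by (simp add: target_def card_PiE nat_add_distrib nat_mult_distrib)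
  also have "\<dots> < card box"
    using less fin by (simp add: box_def card_PiE K_def mult.assoc)
  finally have "\<not> inj_on F box" by (rule pigeonhole)
  then obtain x y where xy: "x \<in> box" "y \<in> box" "F x = F y" "x \<noteq> y"
    by (auto simp: inj_on_def)
  define c where "c j = (if j \<in> L then int (x j) - int (y j) else 0)" for j
  show ?thesis
  proof (intro exI[of _ c] conjI allI ballI impI)
    obtain j where "x j \<noteq> y j" using \<open>x \<noteq> y\<close> by blast
    \<comment> \<open>Outside \<open>L\<close> both functions are \<open>undefined\<close>, so they
      can only differ inside \<open>L\<close>.\<close>
    then have "c j \<noteq> 0" using xy by (auto simp: c_def box_def PiE_iff extensional_def)
    then show "\<exists>j. c j \<noteq> 0" ..
  next
    fix j
    show "\<bar>c j\<bar> \<le> int H"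
    proof (cases "j \<in> L")
      case True
      then have "x j \<le> H" "y j \<le> H" using xy by (auto simp: box_def PiE_iff)
      then show ?thesis by (auto simp: c_def abs_le_iff)
    qed (simp add: c_def)
  next
    fix i assume "i \<in> R"
    then show "(\<Sum>j\<in>L. a i j * c j) = 0"
      using fun_cong[OF xy(3), of i]
      by (simp add: F_def c_def right_diff_distrib sum_subtractf)
  qed (simp add: c_def)
qed

text \<open>A nontrivial relation puts the column rank, hence the row rank, below
  \<open>card L\<close>, so fewer than \<open>card L\<close> rows imply all others. The induction is
  Gaussian elimination: each step uses up one row and one column.\<close>

lemma row_selection:
  fixes a :: "'i \<Rightarrow> 'j \<Rightarrow> 'k::field"
  assumes "finite L" "j \<in> L" "c j \<noteq> 0" "\<And>i. i \<in> R \<Longrightarrow> (\<Sum>j\<in>L. a i j * c j) = 0"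
  shows "\<exists>R'\<subseteq>R. finite R' \<and> card R' < card L \<and>
    (\<forall>x. (\<forall>i\<in>R'. (\<Sum>j\<in>L. a i j * x j) = 0) \<longrightarrow> (\<forall>i\<in>R. (\<Sum>j\<in>L. a i j * x j) = 0))"
  using assms
proof (induction L arbitrary: a j rule: finite_psubset_induct)
  case (psubset L)
  show ?case
  proof (cases "\<forall>i\<in>R. \<forall>j\<in>L. a i j = 0")
    case True
    \<comment> \<open>Every equation is trivial here, and \<open>j \<in> L\<close> makes
      \<open>card L\<close> positive.\<close>
    then show ?thesis using psubset.hyps psubset.prems
      by (intro exI[of _ "{}"]) (auto simp: card_gt_0_iff)
  next
    case False
    then obtain r p where rp: "r \<in> R" "p \<in> L" "a r p \<noteq> 0" by blast
    define L' where "L' = L - {p}"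
    \<comment> \<open>A multiple of the pivot row \<open>r\<close> is subtracted to clear column
      \<open>p\<close>. By \<open>split\<close>, reduced and original sums agree at every
      \<open>x\<close> that satisfies row \<open>r\<close>.\<close>
    define a' where "a' i j = a i j - a i p / a r p * a r j" for i j
    have L: "finite L" "finite L'" "L' \<subset> L" "L = insert p L'" "p \<notin> L'"
      using rp psubset.hyps by (auto simp: L'_def)
    have split: "(\<Sum>j\<in>L. a i j * x j) = (\<Sum>j\<in>L'. a' i j * x j) + a i p / a r p * (\<Sum>j\<in>L. a r j * x j)"
      for i x
      using L rp by (simp add: a'_def sum_subtractf sum_distrib_left algebra_simps)
    have orth: "(\<Sum>j\<in>L'. a' i j * c j) = 0" if "i \<in> R" for i
      using split[of i c] psubset.prems(3)[OF that] psubset.prems(3)[OF rp(1)] by simp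
    \<comment> \<open>The relation survives the removal of \<open>p\<close>: if it were supported on
      \<open>p\<close> alone, row \<open>r\<close> would force \<open>c p = 0\<close>.\<close>
    have "\<exists>q\<in>L'. c q \<noteq> 0"
    proof (rule ccontr)
      assume "\<not> (\<exists>q\<in>L'. c q \<noteq> 0)"
      then have z: "\<And>q. q \<in> L' \<Longrightarrow> c q = 0" by blast
      then have "a r p * c p = 0" using psubset.prems(3)[OF rp(1)] L by simp
      then show False using z psubset.prems rp L by auto
    qed
    then obtain q where q: "q \<in> L'" "c q \<noteq> 0" by blast
    obtain R' where R': "R' \<subseteq> R" "finite R'" "card R' < card L'"
      and imp: "\<And>x. (\<forall>i\<in>R'. (\<Sum>j\<in>L'. a' i j * x j) = 0) \<Longrightarrow> (\<forall>i\<in>R. (\<Sum>j\<in>L'. a' i j * x j) = 0)"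
      using psubset.IH[OF L(3) q, of a'] orth by auto
    show ?thesis
    proof (intro exI[of _ "insert r R'"] conjI allI impI)
      show "insert r R' \<subseteq> R" "finite (insert r R')" using R' rp by auto
      show "card (insert r R') < card L" using R' L by (simp add: card_insert_if)
      fix x assume x: "\<forall>i\<in>insert r R'. (\<Sum>j\<in>L. a i j * x j) = 0"
      then have "(\<Sum>j\<in>L'. a' i j * x j) = 0" if "i \<in> R'" for i
        using split[of i x] that by simp
      then have "\<forall>i\<in>R. (\<Sum>j\<in>L'. a' i j * x j) = 0" using imp by blast
      then show "\<forall>i\<in>R. (\<Sum>j\<in>L. a i j * x j) = 0" using split[of _ x] x by simp
    qed
  qed
qed

text \<open>The bound depends on the number of rows but not on \<open>card L\<close>. To get this,
  \<open>r < card L\<close> rows that imply the others are kept, and only \<open>r + 1\<close>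
  columns, so that there is exactly one more unknown than equations when
  \<open>siegel_pigeonhole\<close> is applied.\<close>

lemma small_integer_relation:
  fixes a :: "'i \<Rightarrow> 'j \<Rightarrow> int" and c :: "'j \<Rightarrow> int" and D :: nat
  assumes fin: "finite L" "finite R"
    and a: "\<forall>i\<in>R. \<forall>j\<in>L. \<bar>a i j\<bar> \<le> int D" and D: "0 < D"
    and c: "j \<in> L" "c j \<noteq> 0" "\<forall>i\<in>R. (\<Sum>j\<in>L. a i j * c j) = 0"
  shows "\<exists>c'::'j \<Rightarrow> int. (\<exists>j. c' j \<noteq> 0) \<and> (\<forall>j. j \<notin> L \<longrightarrow> c' j = 0) \<and>
    (\<forall>j. \<bar>c' j\<bar> \<le> int ((2 * (card R + 1) * D) ^ card R)) \<and>
    (\<forall>i\<in>R. (\<Sum>j\<in>L. a i j * c' j) = 0)"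
proof -
  have "(\<Sum>j\<in>L. real_of_int (a i j) * real_of_int (c j)) = 0" if "i \<in> R" for i
    using arg_cong[OF c(3)[rule_format, OF that], of real_of_int] by simp
  then obtain R' where R': "R' \<subseteq> R" "finite R'" "card R' < card L"
    and imp: "\<And>x. (\<forall>i\<in>R'. (\<Sum>j\<in>L. real_of_int (a i j) * x j) = 0) \<Longrightarrow>
      (\<forall>i\<in>R. (\<Sum>j\<in>L. real_of_int (a i j) * x j) = 0)"
    using row_selection[OF fin(1) c(1), of "\<lambda>j. real_of_int (c j)" R "\<lambda>i j. real_of_int (a i j)"] c(2)
    by auto
  define r where "r = card R'"
  obtain L' where L': "L' \<subseteq> L" "card L' = r + 1"
    using obtain_subset_with_card_n[of "r + 1" L] R'(3) unfolding r_def by (metis Suc_eq_plus1 Suc_leI)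
  have finL': "finite L'" using L' fin finite_subset by blast
  \<comment> \<open>With \<open>Q = 2 * (r + 1) * D\<close> there are at most
    \<open>(Q * (H + 1)) ^ r\<close> value vectors. The choice \<open>H = Q ^ r\<close> turns this
    into \<open>H * (H + 1) ^ r\<close>, just below \<open>(H + 1) ^ (r + 1)\<close>.\<close>
  define H where "H = (2 * (r + 1) * D) ^ r"
  have "2 * card L' * H * D + 1 \<le> (2 * (r + 1) * D) * (H + 1)"
    using D by (simp add: L' algebra_simps)
  then have "(2 * card L' * H * D + 1) ^ card R' \<le> ((2 * (r + 1) * D) * (H + 1)) ^ r"
    unfolding r_def[symmetric] by (rule power_mono) simp
  also have "\<dots> = H * (H + 1) ^ r" by (simp only: power_mult_distrib[of "2 * (r + 1) * D" "H + 1" r] H_def[symmetric])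
  also have "\<dots> < (H + 1) ^ card L'" by (simp add: L')
  finally have less: "(2 * card L' * H * D + 1) ^ card R' < (H + 1) ^ card L'" .
  have a': "\<forall>i\<in>R'. \<forall>j\<in>L'. \<bar>a i j\<bar> \<le> int D"
    using a R'(1) L'(1) by blast
  obtain d where d: "\<exists>j. d j \<noteq> 0" "\<forall>j. j \<notin> L' \<longrightarrow> d j = 0" "\<forall>j. \<bar>d j\<bar> \<le> int H"
    "\<forall>i\<in>R'. (\<Sum>j\<in>L'. a i j * d j) = 0"
    using siegel_pigeonhole[OF finL' R'(2) a' less] by blast
  have rR: "r \<le> card R" unfolding r_def using R' fin by (intro card_mono)
  have "H \<le> (2 * (card R + 1) * D) ^ r"
    unfolding H_def using rR by (intro power_mono mult_mono) auto
  also have "\<dots> \<le> (2 * (card R + 1) * D) ^ card R"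
    using rR D by (intro power_increasing) auto
  finally have H: "H \<le> (2 * (card R + 1) * D) ^ card R" .
  have sumL: "(\<Sum>j\<in>L. a i j * d j) = (\<Sum>j\<in>L'. a i j * d j)" for i
    using L' fin d(2) by (intro sum.mono_neutral_right) auto
  have "(\<Sum>j\<in>L. real_of_int (a i j) * real_of_int (d j)) = 0" if "i \<in> R'" for i
    using arg_cong[OF d(4)[rule_format, OF that], of real_of_int] sumL[of i, THEN arg_cong[where f = real_of_int]]
    by simp
  then have real0: "(\<Sum>j\<in>L. real_of_int (a i j) * real_of_int (d j)) = 0" if "i \<in> R" for i
    using imp[of "\<lambda>j. real_of_int (d j)"] that by blast
  have "(\<Sum>j\<in>L. a i j * d j) = 0" if "i \<in> R" for i
  proof -
    have "real_of_int (\<Sum>j\<in>L. a i j * d j) = 0" using real0[OF that] by simp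
    then show ?thesis by linarith
  qed
  moreover have "\<bar>d j\<bar> \<le> int ((2 * (card R + 1) * D) ^ card R)" for j
    using d(3)[rule_format, of j] H by linarith
  ultimately show ?thesis using d(1,2) L'(1) by (intro exI[of _ d]) blast
qed

section \<open>Counting bounded functions of small support\<close>

text \<open>A function with at most \<open>s + 1\<close> nonzero values arises from one with at most
  \<open>s\<close> by overwriting a single value, for which there are \<open>n * (M + 1)\<close>
  choices of position and value.\<close>

lemma card_sparse_functions:
  fixes M n s :: nat
  defines "F \<equiv> \<lambda>s. {h::nat \<Rightarrow> nat. (\<forall>j. n \<le> j \<longrightarrow> h j = 0) \<and> (\<forall>j. h j \<le> M) \<and> card {j. h j \<noteq> 0} \<le> s}"
  assumes "0 < n"
  shows "finite (F s) \<and> card (F s) \<le> (n * (M + 1)) ^ s"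
proof (induction s)
  case 0
  have "h = (\<lambda>_. 0)" if "h \<in> F 0" for h
  proof -
    \<comment> \<open>Finiteness has to be established first, because \<open>card\<close> is 0 on
      infinite sets as well.\<close>
    have "{j. h j \<noteq> 0} \<subseteq> {..<n}" using that by (auto simp: F_def not_less[symmetric])
    then have "finite {j. h j \<noteq> 0}" by (rule finite_subset) simp
    then show ?thesis using that by (auto simp: F_def)
  qed
  then have "F 0 \<subseteq> {\<lambda>_. 0}" by blast
  then show ?case using card_mono[of "{\<lambda>_. 0}" "F 0"] finite_subset by auto
next
  case (Suc s)
  define G where "G = (\<lambda>((j, v), h). h(j := v)) ` (({..<n} \<times> {..M}) \<times> F s)"
  have "h \<in> G" if h: "h \<in> F (Suc s)" for h
  proof -
    have "{j. h j \<noteq> 0} \<subseteq> {..<n}" using h by (auto simp: F_def not_less[symmetric])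
    then have fin: "finite {j. h j \<noteq> 0}" by (rule finite_subset) simp
    \<comment> \<open>For the zero function any position below \<open>n\<close> will do: overwriting
      with 0 changes nothing.\<close>
    obtain j where j: "j < n" "{j. h j \<noteq> 0} \<noteq> {} \<Longrightarrow> h j \<noteq> 0"
    proof (cases "{j. h j \<noteq> 0} = {}")
      case True
      then show ?thesis using that[of 0] \<open>0 < n\<close> by simp
    next
      case False
      then obtain j where "h j \<noteq> 0" by blast
      moreover have "j < n" using h \<open>h j \<noteq> 0\<close> by (auto simp: F_def not_less[symmetric])
      ultimately show ?thesis using that by blast
    qed
    have "{i. (h(j := 0)) i \<noteq> 0} = {i. h i \<noteq> 0} - {j}" by auto
    moreover have "card ({i. h i \<noteq> 0} - {j}) \<le> s"
    proof (cases "{j. h j \<noteq> 0} = {}")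
      case False
      then have "j \<in> {i. h i \<noteq> 0}" using j by simp
      then show ?thesis using fin h by (auto simp: F_def)
    qed simp
    ultimately have "h(j := 0) \<in> F s" using h by (auto simp: F_def)
    moreover have "h = (h(j := 0))(j := h j)" by simp
    moreover have "h j \<le> M" using h by (simp add: F_def)
    ultimately show ?thesis using j(1) unfolding G_def
      by (intro image_eqI[of _ _ "((j, h j), h(j := 0))"]) auto
  qed
  then have sub: "F (Suc s) \<subseteq> G" by blast
  have fin: "finite (({..<n} \<times> {..M}) \<times> F s)" using Suc by simp
  have "card G \<le> card (({..<n} \<times> {..M}) \<times> F s)" unfolding G_def using fin by (rule card_image_le)
  also have "\<dots> = n * (M + 1) * card (F s)" by (simp add: card_cartesian_product)
  also have "\<dots> \<le> n * (M + 1) * (n * (M + 1)) ^ s" using Suc by (intro mult_left_mono) auto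
  finally have "card G \<le> (n * (M + 1)) ^ Suc s" by simp
  moreover have "finite G" using fin by (simp add: G_def)
  ultimately show ?case using sub card_mono finite_subset by (meson order.trans)
qed

section \<open>Rigid solutions: support and number\<close>

text \<open>
  A rigid \<open>f\<close> is not the midpoint of two other nonnegative integer solutions of the same system.
\<close>

definition rigid :: "(nat \<Rightarrow> nat \<Rightarrow> int) \<Rightarrow> nat \<Rightarrow> nat \<Rightarrow> (nat \<Rightarrow> nat) \<Rightarrow> bool" where
  "rigid a m n f \<longleftrightarrow> (\<forall>j\<ge>n. f j = 0) \<and>
     (\<forall>c. (\<exists>j. c j \<noteq> 0) \<longrightarrow> (\<forall>j. \<bar>c j\<bar> \<le> int (f j)) \<longrightarrow> (\<exists>i<m. (\<Sum>j<n. a i j * c j) \<noteq> 0))"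

lemma rigid_support_subset:
  assumes "rigid a m n f"
  shows "{j. f j \<noteq> 0} \<subseteq> {..<n}"
proof
  have "\<forall>j\<ge>n. f j = 0" using assms unfolding rigid_def by (rule conjunct1)
  then show "j \<in> {..<n}" if "j \<in> {j. f j \<noteq> 0}" for j using that by (cases "j < n") auto
qed

lemma rigid_no_relation:
  assumes "rigid a m n f" "\<exists>j. c j \<noteq> 0" "\<And>j. \<bar>c j\<bar> \<le> int (f j)"
    and L: "L \<subseteq> {..<n}" "\<And>j. j \<notin> L \<Longrightarrow> c j = 0"
    and c: "\<And>i. i < m \<Longrightarrow> (\<Sum>j\<in>L. a i j * c j) = 0"
  shows False
proof -
  have "(\<Sum>j<n. a i j * c j) = (\<Sum>j\<in>L. a i j * c j)" for i
    using L by (intro sum.mono_neutral_right) auto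
  then show ?thesis using assms(1-3) c unfolding rigid_def by metis
qed

text \<open>If the bound failed, \<open>siegel_pigeonhole\<close> with \<open>H = 1\<close> on the
  support would give a relation with entries in {-1, 0, 1}. It is dominated by \<open>f\<close>,
  which is at least 1 on its support.\<close>

lemma rigid_support_bound:
  assumes f: "rigid a m n f" and a: "\<And>i j. i < m \<Longrightarrow> j < n \<Longrightarrow> \<bar>a i j\<bar> \<le> int D"
  defines "s \<equiv> card {j. f j \<noteq> 0}"
  shows "2 ^ s \<le> (2 * s * D + 1) ^ m"
proof (rule ccontr)
  define S where "S = {j. f j \<noteq> 0}"
  have S: "S \<subseteq> {..<n}" using rigid_support_subset[OF f] by (simp add: S_def)
  then have fin: "finite S" by (rule finite_subset) simp
  assume "\<not> 2 ^ s \<le> (2 * s * D + 1) ^ m"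
  then have less: "(2 * card S * 1 * D + 1) ^ card {..<m} < (1 + 1) ^ card S"
    by (simp add: s_def S_def not_le numeral_2_eq_2)
  have a': "\<forall>i\<in>{..<m}. \<forall>j\<in>S. \<bar>a i j\<bar> \<le> int D"
    using a S by blast
  obtain c where c: "\<exists>j. c j \<noteq> 0" "\<forall>j. j \<notin> S \<longrightarrow> c j = 0" "\<forall>j. \<bar>c j\<bar> \<le> int 1"
    "\<forall>i\<in>{..<m}. (\<Sum>j\<in>S. a i j * c j) = 0"
    using siegel_pigeonhole[OF fin finite_lessThan a' less] by blast
  have "\<bar>c j\<bar> \<le> int (f j)" for j
    using c(2,3)[rule_format, of j] by (cases "j \<in> S") (auto simp: S_def)
  then show False using rigid_no_relation[OF f c(1) _ S] c(2,4) by simp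
qed

text \<open>Truncation at \<open>M\<close> is injective on \<open>T\<close>. If \<open>f\<close> and
  \<open>g\<close> have the same truncation, their difference is a relation between the columns with
  \<open>f j \<ge> M\<close>. By \<open>small_integer_relation\<close> these columns also carry a
  relation bounded by \<open>M\<close>, hence by \<open>f\<close>, against rigidity.\<close>

lemma card_rigid_solutions:
  assumes pos: "0 < n" "0 < D"
    and a: "\<And>i j. i < m \<Longrightarrow> j < n \<Longrightarrow> \<bar>a i j\<bar> \<le> int D"
    and rigid: "\<And>f. f \<in> T \<Longrightarrow> rigid a m n f"
    and sol: "\<And>f i. f \<in> T \<Longrightarrow> i < m \<Longrightarrow> (\<Sum>j<n. a i j * int (f j)) = b i"
    and s: "\<And>f. f \<in> T \<Longrightarrow> card {j. f j \<noteq> 0} \<le> s"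
  shows "finite T \<and> card T \<le> (n * ((2 * (m + 1) * D) ^ m + 1)) ^ s"
proof -
  define M where "M = (2 * (m + 1) * D) ^ m"
  have "0 < M" using pos by (simp add: M_def)
  define trunc where "trunc f = (\<lambda>j. min (f j) M)" for f :: "nat \<Rightarrow> nat"
  define F where "F = {h::nat \<Rightarrow> nat. (\<forall>j. n \<le> j \<longrightarrow> h j = 0) \<and> (\<forall>j. h j \<le> M) \<and> card {j. h j \<noteq> 0} \<le> s}"
  have F: "finite F" "card F \<le> (n * (M + 1)) ^ s"
    using card_sparse_functions[OF pos(1), of M s] by (auto simp: F_def)
  have "trunc f \<in> F" if "f \<in> T" for f
  proof -
    \<comment> \<open>Since \<open>M\<close> is positive, truncation keeps the support.\<close>
    have "{j. trunc f j \<noteq> 0} = {j. f j \<noteq> 0}" using \<open>0 < M\<close> by (auto simp: trunc_def)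
    then show ?thesis using s[OF that] rigid[OF that] by (simp add: F_def rigid_def) (simp add: trunc_def)
  qed
  then have sub: "trunc ` T \<subseteq> F" by blast
  have inj: "inj_on trunc T"
  proof (rule inj_onI, rule ccontr)
    fix f g assume fg: "f \<in> T" "g \<in> T" "trunc f = trunc g" "f \<noteq> g"
    define L where "L = {j. j < n \<and> M \<le> f j}"
    define c where "c j = int (f j) - int (g j)" for j
    obtain j where "f j \<noteq> g j" using fg(4) by blast
    then have j: "c j \<noteq> 0" by (simp add: c_def)
    have off: "c j = 0" if "j \<notin> L" for j
    proof (cases "j < n")
      case True
      \<comment> \<open>Here \<open>f j < M\<close>, so \<open>min (g j) M = f j\<close> forces
        \<open>g j = f j\<close>.\<close>
      then show ?thesis using fun_cong[OF fg(3), of j] that by (auto simp: trunc_def c_def L_def min_def split: if_splits)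
    next
      case False
      then show ?thesis using rigid[OF fg(1)] rigid[OF fg(2)] by (simp add: rigid_def c_def)
    qed
    have L: "finite L" "L \<subseteq> {..<n}" by (auto simp: L_def)
    have ker: "\<forall>i\<in>{..<m}. (\<Sum>j\<in>L. a i j * c j) = 0"
    proof
      fix i assume "i \<in> {..<m}"
      then have "(\<Sum>j<n. a i j * c j) = 0"
        using sol[OF fg(1), of i] sol[OF fg(2), of i]
        by (simp add: c_def right_diff_distrib sum_subtractf)
      also have "(\<Sum>j<n. a i j * c j) = (\<Sum>j\<in>L. a i j * c j)"
        using L off by (intro sum.mono_neutral_right) auto
      finally show "(\<Sum>j\<in>L. a i j * c j) = 0" .
    qed
    have a': "\<forall>i\<in>{..<m}. \<forall>j\<in>L. \<bar>a i j\<bar> \<le> int D"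
      using a L(2) by blast
    have "j \<in> L" using j off by blast
    obtain d where d: "\<exists>j. d j \<noteq> 0" "\<forall>j. j \<notin> L \<longrightarrow> d j = 0"
      "\<forall>j. \<bar>d j\<bar> \<le> int ((2 * (card {..<m} + 1) * D) ^ card {..<m})"
      "\<forall>i\<in>{..<m}. (\<Sum>j\<in>L. a i j * d j) = 0"
      using small_integer_relation[of L "{..<m}", OF L(1) finite_lessThan a' pos(2) \<open>j \<in> L\<close> j ker]
      by blast
    have "\<bar>d j\<bar> \<le> int (f j)" for j
    proof (cases "j \<in> L")
      case True
      then have "int M \<le> int (f j)" by (simp add: L_def)
      then show ?thesis using d(3)[rule_format, of j] unfolding card_lessThan M_def[symmetric] by linarith
    qed (simp add: d(2))
    then show False using rigid_no_relation[OF rigid[OF fg(1)] d(1) _ L(2)] d(2,4) by simp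
  qed
  have "finite T" using sub F(1) inj finite_imageD finite_subset by blast
  moreover have "card T \<le> card F" using card_inj_on_le[OF inj sub F(1)] .
  ultimately show ?thesis using F(2) by (simp add: M_def)
qed

section \<open>Estimates for the exponent\<close>

text \<open>This is \<open>ln x \<le> x - 1\<close> at \<open>x = t / 4\<close>. A slope below 1 is
  what allows \<open>log 2 t\<close> to be absorbed into \<open>t\<close> in
  \<open>support_estimate\<close>.\<close>

lemma log_le_half_plus_1:
  fixes t :: real
  assumes "0 < t"
  shows "log 2 t \<le> t / 2 + 1"
proof -
  have l2: "1 / 2 \<le> ln (2::real)" "ln (2::real) \<le> 1"
    using ln_le_minus_one[of "1 / 2 :: real"] ln_le_minus_one[of "2 :: real"] by (simp_all add: ln_div)
  have "ln (4::real) = 2 * ln 2" using ln_realpow[of "2::real" 2] by simp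
  then have "ln t \<le> 2 * ln 2 - 1 + t / 4"
    using ln_le_minus_one[of "t / 4"] assms by (simp add: ln_div)
  also have "\<dots> \<le> (t / 2 + 1) * ln 2"
  proof -
    have "0 \<le> t / 2 * (ln 2 - 1 / 2)" using assms l2(1) by simp
    then show ?thesis using l2(2) by (simp add: algebra_simps)
  qed
  finally show ?thesis by (simp add: log_def divide_le_eq)
qed

text \<open>The inequality \<open>le\<close> bounds \<open>s\<close> by \<open>m\<close> times a
  logarithm of \<open>s\<close> itself. For \<open>t = s / m\<close> it reads
  \<open>t \<le> log 2 3 + log 2 (m * D) + log 2 t\<close>, and bounding the last term by
  \<open>t / 2 + 1\<close> gives \<open>t \<le> 6 + 4 * l\<close>. The product \<open>m * s\<close>
  is estimated because it governs the exponent in the final count.\<close>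

lemma support_estimate:
  fixes m s D :: nat
  assumes "0 < m" "0 < D" and le: "2 ^ s \<le> (2 * s * D + 1) ^ m"
  shows "real m * real s \<le> 16 * max 1 ((real m)\<^sup>2 * log 2 (sqrt (real m) * real D))"
proof -
  define l where "l = log 2 (sqrt (real m) * real D)"
  have sq: "1 \<le> sqrt (real m)" using assms by simp
  have D: "1 \<le> real D" using assms by simp
  have "1 \<le> sqrt (real m) * real D" using mult_mono[OF sq D] by simp
  then have l0: "0 \<le> l" by (simp add: l_def)
  have mD: "log 2 (real m * real D) \<le> 2 * l"
  proof -
    have "log 2 (real m * real D) \<le> log 2 (real m * (real D)\<^sup>2)"
      using assms D by (subst log_le_cancel_iff) (auto simp: power2_eq_square)
    also have "real m * (real D)\<^sup>2 = (sqrt (real m) * real D)\<^sup>2" by (simp add: power_mult_distrib)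
    also have "log 2 \<dots> = 2 * l" using assms by (simp add: l_def log_nat_power)
    finally show ?thesis .
  qed
  have "real s \<le> real m * (6 + 4 * l)"
  proof (cases "s = 0")
    case True
    then show ?thesis using l0 by simp
  next
    case False
    define t where "t = real s / real m"
    have t: "0 < t" "real s = real m * t" using False assms by (auto simp: t_def)
    \<comment> \<open>As \<open>s\<close> and \<open>D\<close> are at least 1, the summand 1 is at
      most \<open>s * D\<close>.\<close>
    have "(2::nat) ^ s \<le> (3 * s * D) ^ m"
      using le False assms by (elim order_trans) (intro power_mono, auto)
    then have "real (2 ^ s) \<le> real ((3 * s * D) ^ m)" by (rule of_nat_mono)
    then have "log 2 (2 ^ s) \<le> log 2 ((3 * real s * real D) ^ m)"
      using False assms by (subst log_le_cancel_iff) auto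
    then have "real s \<le> real m * log 2 (3 * real s * real D)"
      using False assms by (simp add: log_nat_power)
    then have "t \<le> log 2 (3 * real s * real D)"
      using assms by (simp add: t_def field_simps)
    also have "3 * real s * real D = 3 * (real m * real D) * t" using t by simp
    also have "log 2 \<dots> = log 2 3 + log 2 (real m * real D) + log 2 t"
      using assms t by (simp add: log_mult)
    also have "log 2 3 \<le> (2::real)"
      by (subst log_le_iff) auto
    also have "log 2 t \<le> t / 2 + 1" using t by (intro log_le_half_plus_1)
    finally have "t \<le> 6 + 4 * l" using mD by linarith
    then show ?thesis using t by (simp add: mult_left_mono)
  qed
  then have "real m * real s \<le> real m * (real m * (6 + 4 * l))" by (intro mult_left_mono) auto
  also have "\<dots> = 6 * (real m)\<^sup>2 + 4 * ((real m)\<^sup>2 * l)" by (simp add: power2_eq_square algebra_simps)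
  also have "\<dots> \<le> 16 * max 1 ((real m)\<^sup>2 * l)"
  proof (cases "m = 1 \<and> D = 1")
    case True
    then show ?thesis by (simp add: l_def)
  next
    case False
    \<comment> \<open>Now \<open>m * D \<ge> 2\<close>. With \<open>l \<ge> 1 / 2\<close> the term
      \<open>6 * m^2\<close> is at most \<open>12 * m^2 * l\<close>, and 12 + 4 gives the constant
      16.\<close>
    have "1 / 2 \<le> l"
    proof (rule ccontr)
      assume "\<not> ?thesis"
      then have "log 2 (real m * real D) < log 2 2" using mD by simp
      then have "real m * real D < 2" using assms by (subst (asm) log_less_cancel_iff) auto
      then have "m * D < 2" by (metis of_nat_less_iff of_nat_mult of_nat_numeral)
      then have "m * D = 1" using assms by (metis One_nat_def less_2_cases_iff mult_is_0 neq0_conv)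
      then show False using False by simp
    qed
    then have "(real m)\<^sup>2 * (1 / 2) \<le> (real m)\<^sup>2 * l" by (intro mult_left_mono) auto
    then show ?thesis using max.cobounded2[of "(real m)\<^sup>2 * l" 1] by linarith
  qed
  finally show ?thesis by (simp add: l_def)
qed

text \<open>For \<open>N = m * n * D \<ge> 2\<close> the base of the count in
  \<open>card_rigid_solutions\<close> is at most \<open>N ^ (5 * m)\<close>. Together with
  \<open>m * s \<le> 16 * E\<close> this gives the exponent
  \<open>5 * 16 * E = 80 * E\<close>.\<close>

lemma card_rigid_solutions_powr:
  assumes pos: "0 < m" "0 < n" "0 < D"
    and a: "\<And>i j. i < m \<Longrightarrow> j < n \<Longrightarrow> \<bar>a i j\<bar> \<le> int D"
    and nz: "\<exists>i<m. \<exists>j<n. a i j \<noteq> 0"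
    and rigid: "\<And>f. f \<in> T \<Longrightarrow> rigid a m n f"
    and sol: "\<And>f i. f \<in> T \<Longrightarrow> i < m \<Longrightarrow> (\<Sum>j<n. a i j * int (f j)) = b i"
  defines "E \<equiv> max 1 ((real m)\<^sup>2 * log 2 (sqrt (real m) * real D))"
  shows "finite T \<and> real (card T) \<le> (real m * real n * real D) powr (80 * E)"
proof -
  define N where "N = m * n * D"
  have "0 < N" using pos by (simp add: N_def)
  have E: "1 \<le> E" by (simp add: E_def)
  define s where "s = nat \<lfloor>16 * E / real m\<rfloor>"
  have sE: "real m * real s \<le> 16 * E"
  proof -
    have "real s \<le> 16 * E / real m" using E pos by (simp add: s_def)
    then show ?thesis using pos by (simp add: field_simps)
  qed
  have supp: "card {j. f j \<noteq> 0} \<le> s" if "f \<in> T" for f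
  proof -
    have "real m * real (card {j. f j \<noteq> 0}) \<le> 16 * E"
      unfolding E_def using support_estimate[OF pos(1,3) rigid_support_bound[OF rigid[OF that] a]] .
    then have "real (card {j. f j \<noteq> 0}) \<le> 16 * E / real m" using pos by (simp add: field_simps)
    then show ?thesis unfolding s_def by (simp add: le_nat_floor)
  qed
  have fin: "finite T" and card: "card T \<le> (n * ((2 * (m + 1) * D) ^ m + 1)) ^ s"
    using card_rigid_solutions[OF pos(2,3) a rigid sol supp] by auto
  have "real (card T) \<le> real N powr (80 * E)"
  proof (cases "N = 1")
    case True
    \<comment> \<open>The claimed bound equals 1 here, so uniqueness is needed: one equation in one
      unknown with a nonzero coefficient.\<close>
    then have mnD: "m = 1" "n = 1" "D = 1" by (auto simp: N_def)
    have "f = g" if "f \<in> T" "g \<in> T" for f g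
    proof
      fix j
      have "a 0 0 * int (f 0) = a 0 0 * int (g 0)" "a 0 0 \<noteq> 0"
        using sol[OF that(1), of 0] sol[OF that(2), of 0] nz mnD by auto
      moreover have "0 < j \<Longrightarrow> f j = 0 \<and> g j = 0"
        using rigid[OF that(1)] rigid[OF that(2)] mnD by (simp add: rigid_def)
      ultimately show "f j = g j" by (cases "j = 0") auto
    qed
    then have "card T \<le> 1" using fin by (auto simp: card_le_Suc0_iff_eq)
    then show ?thesis using True by simp
  next
    case False
    then have N2: "2 \<le> N" using \<open>0 < N\<close> by linarith
    have mN: "m * D \<le> N" "n \<le> N" using pos by (auto simp: N_def)
    \<comment> \<open>Numerical factors are absorbed into powers of \<open>N \<ge> 2\<close>: 4 into
      \<open>N ^ 2\<close>, and below the 2 from doubling into \<open>N ^ m\<close>.\<close>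
    have "2 * (m + 1) * D \<le> 4 * (m * D)" using pos by (simp add: algebra_simps)
    also have "\<dots> \<le> N ^ 2 * N" using power_mono[OF N2, of 2] mN by (intro mult_mono) auto
    finally have "(2 * (m + 1) * D) ^ m \<le> (N ^ 3) ^ m"
      by (intro power_mono) (auto simp: eval_nat_numeral)
    also have "\<dots> = N ^ (3 * m)" by (simp add: power_mult)
    finally have "(2 * (m + 1) * D) ^ m + 1 \<le> N ^ (3 * m) + N ^ (3 * m)"
      using \<open>0 < N\<close> by (intro add_mono) auto
    also have "\<dots> \<le> N ^ m * N ^ (3 * m)"
      using N2 self_le_power[of N m] pos by (simp add: mult_2[symmetric])
    finally have "n * ((2 * (m + 1) * D) ^ m + 1) \<le> N ^ m * (N ^ m * N ^ (3 * m))"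
      using self_le_power[of N m] pos mN N2 by (intro mult_mono) auto
    also have "\<dots> = N ^ (5 * m)" by (simp add: power_add[symmetric])
    finally have "(n * ((2 * (m + 1) * D) ^ m + 1)) ^ s \<le> (N ^ (5 * m)) ^ s"
      by (intro power_mono) auto
    then have "card T \<le> N ^ (5 * m * s)" using card by (simp add: power_mult)
    then have "real (card T) \<le> real (N ^ (5 * m * s))" by (rule of_nat_mono)
    also have "\<dots> = real N powr (5 * (real m * real s))"
      using N2 by (simp add: powr_realpow[symmetric] mult.assoc)
    also have "\<dots> \<le> real N powr (80 * E)" using sE N2 by (intro powr_mono) auto
    finally show ?thesis .
  qed
  then show ?thesis using fin by (simp add: N_def)
qed

section \<open>Vertices of the integer hull as rigid solutions\<close>

lemma std_polyhedron_alt: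
  assumes "A \<in> carrier_mat m n" "b \<in> carrier_vec m"
  shows "std_polyhedron A b = {x. (\<forall>j\<ge>n. Poly_Mapping.lookup x j = 0) \<and> (\<forall>j. 0 \<le> Poly_Mapping.lookup x j) \<and>
    (\<forall>i<m. (\<Sum>j<n. real_of_int (A $$ (i, j)) * Poly_Mapping.lookup x j) = real_of_int (b $ i))}"
proof -
  have "Poly_Mapping.keys x \<subseteq> {..<n} \<longleftrightarrow> (\<forall>j\<ge>n. Poly_Mapping.lookup x j = 0)" for x :: "nat \<Rightarrow>\<^sub>0 real"
    by (auto simp: in_keys_iff subset_iff) (meson not_less)
  moreover have "map_mat real_of_int A *\<^sub>v Matrix.vec n (Poly_Mapping.lookup x) = map_vec real_of_int b \<longleftrightarrow>
     (\<forall>i<m. (\<Sum>j<n. real_of_int (A $$ (i, j)) * Poly_Mapping.lookup x j) = real_of_int (b $ i))" for x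
    using assms by (auto simp: vec_eq_iff scalar_prod_def lessThan_atLeast0)
  ultimately show ?thesis using assms by (auto simp: std_polyhedron_def)
qed

text \<open>An extreme point of a convex hull lies in the generating set, so \<open>v\<close> is
  itself an integer point of the polyhedron and the floor in \<open>f\<close> loses nothing. A
  nonzero kernel vector \<open>c\<close> dominated by \<open>f\<close> would make \<open>v\<close>
  the midpoint of two distinct points of that set.\<close>

lemma vertex_rigid:
  assumes A: "A \<in> carrier_mat m n" and b: "b \<in> carrier_vec m"
    and v: "v \<in> vertices (integer_hull (std_polyhedron A b))"
  defines "f \<equiv> \<lambda>j. nat \<lfloor>Poly_Mapping.lookup v j\<rfloor>"
  shows "\<forall>j. Poly_Mapping.lookup v j = real (f j)" "rigid (\<lambda>i j. A $$ (i, j)) m n f"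
    "\<forall>i<m. (\<Sum>j<n. A $$ (i, j) * int (f j)) = b $ i"
proof -
  define X where "X = std_polyhedron A b \<inter> integer_points"
  have ext: "v extreme_point_of (convex hull X)"
    using v by (simp add: vertices_def integer_hull_def X_def)
  then have vX: "v \<in> X" by (rule extreme_point_of_convex_hull)
  have f: "Poly_Mapping.lookup v j = real (f j)" for j
  proof -
    have "Poly_Mapping.lookup v j \<in> \<int>" "0 \<le> Poly_Mapping.lookup v j"
      using vX by (auto simp: X_def integer_points_def std_polyhedron_def)
    then show ?thesis by (auto simp: f_def Ints_def)
  qed
  have vP: "\<forall>j\<ge>n. Poly_Mapping.lookup v j = 0"
    "\<forall>i<m. (\<Sum>j<n. real_of_int (A $$ (i, j)) * Poly_Mapping.lookup v j) = real_of_int (b $ i)"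
    using vX unfolding X_def std_polyhedron_alt[OF A b] by auto
  have "(\<Sum>j<n. A $$ (i, j) * int (f j)) = b $ i" if "i < m" for i
  proof -
    have "real_of_int (\<Sum>j<n. A $$ (i, j) * int (f j)) = real_of_int (b $ i)"
      using vP(2) that by (simp add: f)
    then show ?thesis by linarith
  qed
  moreover have "\<exists>i<m. (\<Sum>j<n. A $$ (i, j) * c j) \<noteq> 0"
    if c: "\<exists>j. c j \<noteq> 0" "\<forall>j. \<bar>c j\<bar> \<le> int (f j)" for c
  proof (rule ccontr)
    assume "\<not> ?thesis"
    then have ker: "(\<Sum>j<n. A $$ (i, j) * c j) = 0" if "i < m" for i using that by blast
    have ker': "(\<Sum>j<n. real_of_int (A $$ (i, j)) * real_of_int (c j)) = 0" if "i < m" for i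
      using arg_cong[OF ker[OF that], of real_of_int] by simp
    \<comment> \<open>Domination by \<open>f\<close> confines \<open>c\<close> to the first
      \<open>n\<close> coordinates, so it has finite support and defines a
      \<open>poly_mapping\<close>.\<close>
    have c0: "c j = 0" if "n \<le> j" for j
      using c(2)[rule_format, of j] f[of j] vP(1) that by simp
    then have "{j. real_of_int (c j) \<noteq> 0} \<subseteq> {..<n}" using leI by fastforce
    then have fin: "finite {j. real_of_int (c j) \<noteq> 0}" by (rule finite_subset) simp
    define d where "d = Abs_poly_mapping (\<lambda>j. real_of_int (c j))"
    have d: "Poly_Mapping.lookup d j = real_of_int (c j)" for j
      using fin by (simp add: d_def)
    have mem: "v + d \<in> X" "v - d \<in> X"
    proof -
      have "\<bar>real_of_int (c j)\<bar> \<le> real (f j)" for j using c(2)[rule_format, of j] by linarith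
      then have "0 \<le> real (f j) + real_of_int (c j)" "0 \<le> real (f j) - real_of_int (c j)" for j
        by (auto simp: abs_le_iff) (smt (verit))+
      then show "v + d \<in> X" "v - d \<in> X"
        using vP c0 ker' unfolding X_def std_polyhedron_alt[OF A b]
        by (auto simp: lookup_add lookup_minus d f integer_points_def distrib_left right_diff_distrib
            sum.distrib sum_subtractf)
    qed
    have "v = midpoint (v + d) (v - d)"
    proof -
      have "v + d + (v - d) = 2 *\<^sub>R v"
        by (rule poly_mapping_eqI) (simp add: scaleR_2 lookup_add lookup_minus)
      then show ?thesis by (simp only: midpoint_def) simp
    qed
    moreover have "v + d \<noteq> v - d"
    proof -
      obtain j where "c j \<noteq> 0" using c(1) by blast
      then have "Poly_Mapping.lookup (v + d) j \<noteq> Poly_Mapping.lookup (v - d) j"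
        by (simp add: lookup_add lookup_minus d)
      then show ?thesis by metis
    qed
    ultimately have "v \<in> open_segment (v + d) (v - d)"
      by (metis midpoint_in_open_segment)
    then show False using ext mem hull_inc[of _ X convex] unfolding extreme_point_of_def by blast
  qed
  ultimately show "\<forall>j. Poly_Mapping.lookup v j = real (f j)" "rigid (\<lambda>i j. A $$ (i, j)) m n f"
    "\<forall>i<m. (\<Sum>j<n. A $$ (i, j) * int (f j)) = b $ i"
    using f vP(1) by (simp_all add: rigid_def)
qed

lemma max_abs_entry_ge:
  assumes "A \<in> carrier_mat m n" "i < m" "j < n"
  shows "\<bar>A $$ (i, j)\<bar> \<le> max_abs_entry A"
proof -
  have "elements_mat A = (\<lambda>(i, j). A $$ (i, j)) ` ({..<m} \<times> {..<n})"
    using assms(1) by (auto simp: elements_mat_def)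
  then show ?thesis using assms unfolding max_abs_entry_def by (intro Max_ge) auto
qed

text \<open>The zero matrix has rank 0. The entry found here makes \<open>D\<close> and
  \<open>n\<close> positive and settles the case \<open>N = 1\<close> of the count.\<close>

lemma full_rank_nonzero_entry:
  fixes A :: "int mat"
  assumes "0 < m" "A \<in> carrier_mat m n" "vec_space.rank m (map_mat real_of_int A) = m"
  shows "\<exists>i<m. \<exists>j<n. A $$ (i, j) \<noteq> 0"
proof (rule ccontr)
  assume "\<not> ?thesis"
  then have "map_mat real_of_int A = 0\<^sub>m m n" using assms(2) by (intro eq_matI) auto
  then show False using assms(1,3) by (simp add: vec_space.rank_0I)
qed

theorem corollary3:
  shows "\<exists>C::real. C > 0 \<and>
    (\<forall>(m::nat) (n::nat) (A::int mat) (b::int Matrix.vec).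
       0 < m \<longrightarrow>
       A \<in> carrier_mat m n \<longrightarrow>
       vec_space.rank m (map_mat real_of_int A) = m \<longrightarrow>
       b \<in> carrier_vec m \<longrightarrow>
       std_polyhedron A b \<inter> integer_points \<noteq> {} \<longrightarrow>
       finite (vertices (integer_hull (std_polyhedron A b))) \<and>
       real (card (vertices (integer_hull (std_polyhedron A b))))
         \<le> (real m * real n * real_of_int (max_abs_entry A)) powr
             (C * max 1 ((real m)\<^sup>2 * log 2 (sqrt (real m) * real_of_int (max_abs_entry A)))))"
proof (rule exI[of _ 80], intro conjI allI impI)
  show "(0::real) < 80" by simp
next
  fix m n :: nat and A :: "int mat" and b :: "int Matrix.vec"
  assume m: "0 < m" and A: "A \<in> carrier_mat m n" and rank: "vec_space.rank m (map_mat real_of_int A) = m"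
    and b: "b \<in> carrier_vec m"
  define V where "V = vertices (integer_hull (std_polyhedron A b))"
  define D where "D = nat (max_abs_entry A)"
  obtain i j where ij: "i < m" "j < n" "A $$ (i, j) \<noteq> 0"
    using full_rank_nonzero_entry[OF m A rank] by blast
  then have "0 < max_abs_entry A" using max_abs_entry_ge[OF A ij(1,2)] by linarith
  then have D: "0 < D" "max_abs_entry A = int D" by (auto simp: D_def)
  have le: "\<bar>A $$ (i, j)\<bar> \<le> int D" if "i < m" "j < n" for i j
    using max_abs_entry_ge[OF A that] D by simp
  define F where "F v = (\<lambda>j. nat \<lfloor>Poly_Mapping.lookup v j\<rfloor>)" for v :: "nat \<Rightarrow>\<^sub>0 real"
  have F: "rigid (\<lambda>i j. A $$ (i, j)) m n (F v) \<and>
      (\<forall>i<m. (\<Sum>j<n. A $$ (i, j) * int (F v j)) = b $ i) \<and> (\<forall>j. Poly_Mapping.lookup v j = real (F v j))"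
    if "v \<in> V" for v
    using vertex_rigid[OF A b that[unfolded V_def]] unfolding F_def by blast
  \<comment> \<open>The coordinates of a vertex are the values of its image under \<open>F\<close>,
    so counting the images counts the vertices.\<close>
  then have inj: "inj_on F V" by (intro inj_onI poly_mapping_eqI) metis
  have "0 < n" using ij by simp
  then have "finite (F ` V) \<and> real (card (F ` V)) \<le> (real m * real n * real D) powr
      (80 * max 1 ((real m)\<^sup>2 * log 2 (sqrt (real m) * real D)))"
    using ij F le
    by (intro card_rigid_solutions_powr[where a = "\<lambda>i j. A $$ (i, j)" and b = "\<lambda>i. b $ i", OF m _ D(1)])
      auto
  then have "finite V" "real (card V) \<le> (real m * real n * real D) powr
      (80 * max 1 ((real m)\<^sup>2 * log 2 (sqrt (real m) * real D)))"
    using inj by (auto simp: card_image dest: finite_imageD)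
  then show "finite (vertices (integer_hull (std_polyhedron A b)))"
    "real (card (vertices (integer_hull (std_polyhedron A b))))
      \<le> (real m * real n * real_of_int (max_abs_entry A)) powr
          (80 * max 1 ((real m)\<^sup>2 * log 2 (sqrt (real m) * real_of_int (max_abs_entry A))))"
    by (simp_all add: V_def D(2))
qed

end
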